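(* Let $\mathfrak{s}$ be a Lie algebra and let $\mathfrak{n}$ be a solvable Lie $\mathfrak{s}$-algebra. Then $\mathfrak{n}$ is minimal if and only if it satisfies the following four conditions: 1) $\mathfrak{n}$ is 2-nilpotent, that is, $[\mathfrak{n},D\mathfrak{n}]=0$; 2) $[\mathfrak{s},\mathfrak{n}]=\mathfrak{n}$; 3) $[\mathfrak{s},D\mathfrak{n}]=0$; 4) $\mathfrak{n}/D\mathfrak{n}$ is irreducible as an $\mathfrak{s}$-module.
   Context: All Lie algebras are finite-dimensional over a fixed field $K$ of characteristic zero. $D\mathfrak{n}$ denotes the derived subalgebra of $\mathfrak{n}$. A Lie $\mathfrak{s}$-algebra is a Lie algebra $\mathfrak{n}$ endowed with a Lie algebra morphism $i:\mathfrak{s}\to\mathrm{Der}(\mathfrak{n})$ to the Lie algebra of derivations of $\mathfrak{n}$, such that the resulting action of $\mathfrak{s}$ on $\mathfrak{n}$ is completely reducible; it embeds in $\mathfrak{s}\ltimes\mathfrak{n}$ and one writes $[s,n]=i(s)(n)$. For Lie subalgebras $\mathfrak{h}_1,\mathfrak{h}_2$ of a Lie algebra, $[\mathfrak{h}_1,\mathfrak{h}_2]$ denotes the Lie subalgebra generated by the brackets $[h_1,h_2]$, $h_j\in\mathfrak{h}_j$. An $\mathfrak{s}$-subalgebra of $\mathfrak{n}$ is a Lie subalgebra stable under $\mathfrak{s}$. A Lie $\mathfrak{s}$-algebra $\mathfrak{n}$ is minimal if $[\mathfrak{s},\mathfrak{n}]\neq 0$ and for every $\mathfrak{s}$-subalgebra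 $\mathfrak{n}'$ of $\mathfrak{n}$, either $\mathfrak{n}'=\mathfrak{n}$ or $[\mathfrak{s},\mathfrak{n}']=0$. Irreducible modules are nonzero. *)

theory Defs
  imports HOL.Hull "HOL-Algebra.Module" "HOL-Algebra.QuotRing"
begin

section \<open>Lie algebras\<close>

record ('k, 'a) lie_struct = "('k, 'a) module" +
  bracket :: "'a \<Rightarrow> 'a \<Rightarrow> 'a" (\<open>[_, _]\<^sub>L\<index>\<close>)

text \<open>Module records inherit the fields \<^const>\<open>mult\<close> and \<^const>\<open>one\<close> from rings.
  \<^locale>\<open>module\<close> puts no condition on them, and they play no role here.\<close>

locale lie_algebra = module K L
  for K :: "('k, 'm) ring_scheme" (structure)
    and L :: "('k, 'a, 'r) lie_struct_scheme" (structure) +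
  assumes field: "field K"
    and bracket_closed: "\<lbrakk>x \<in> carrier L; y \<in> carrier L\<rbrakk> \<Longrightarrow> [x, y]\<^sub>L\<^bsub>L\<^esub> \<in> carrier L"
    and bracket_add_left: "\<lbrakk>x \<in> carrier L; y \<in> carrier L; z \<in> carrier L\<rbrakk> \<Longrightarrow>
      [x \<oplus>\<^bsub>L\<^esub> y, z]\<^sub>L\<^bsub>L\<^esub> = [x, z]\<^sub>L\<^bsub>L\<^esub> \<oplus>\<^bsub>L\<^esub> [y, z]\<^sub>L\<^bsub>L\<^esub>"
    and bracket_add_right: "\<lbrakk>x \<in> carrier L; y \<in> carrier L; z \<in> carrier L\<rbrakk> \<Longrightarrow>
      [x, y \<oplus>\<^bsub>L\<^esub> z]\<^sub>L\<^bsub>L\<^esub> = [x, y]\<^sub>L\<^bsub>L\<^esub> \<oplus>\<^bsub>L\<^esub> [x, z]\<^sub>L\<^bsub>L\<^esub>"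
    and bracket_smult_left: "\<lbrakk>a \<in> carrier K; x \<in> carrier L; y \<in> carrier L\<rbrakk> \<Longrightarrow>
      [a \<odot>\<^bsub>L\<^esub> x, y]\<^sub>L\<^bsub>L\<^esub> = a \<odot>\<^bsub>L\<^esub> [x, y]\<^sub>L\<^bsub>L\<^esub>"
    and bracket_smult_right: "\<lbrakk>a \<in> carrier K; x \<in> carrier L; y \<in> carrier L\<rbrakk> \<Longrightarrow>
      [x, a \<odot>\<^bsub>L\<^esub> y]\<^sub>L\<^bsub>L\<^esub> = a \<odot>\<^bsub>L\<^esub> [x, y]\<^sub>L\<^bsub>L\<^esub>"
    and bracket_self: "x \<in> carrier L \<Longrightarrow> [x, x]\<^sub>L\<^bsub>L\<^esub> = \<zero>\<^bsub>L\<^esub>"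
    and jacobi: "\<lbrakk>x \<in> carrier L; y \<in> carrier L; z \<in> carrier L\<rbrakk> \<Longrightarrow>
      [x, [y, z]\<^sub>L\<^bsub>L\<^esub>]\<^sub>L\<^bsub>L\<^esub> \<oplus>\<^bsub>L\<^esub> [y, [z, x]\<^sub>L\<^bsub>L\<^esub>]\<^sub>L\<^bsub>L\<^esub> \<oplus>\<^bsub>L\<^esub> [z, [x, y]\<^sub>L\<^bsub>L\<^esub>]\<^sub>L\<^bsub>L\<^esub> = \<zero>\<^bsub>L\<^esub>"

definition char_zero :: "('k, 'm) ring_scheme \<Rightarrow> bool" where
  "char_zero K \<longleftrightarrow> (\<forall>m::nat. m > 0 \<longrightarrow> [m] \<cdot>\<^bsub>K\<^esub> \<one>\<^bsub>K\<^esub> \<noteq> \<zero>\<^bsub>K\<^esub>)"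

definition finite_dimensional ::
    "('k, 'm) ring_scheme \<Rightarrow> ('k, 'a, 'r) module_scheme \<Rightarrow> bool" where
  "finite_dimensional K V \<longleftrightarrow> (\<exists>B. finite B \<and> B \<subseteq> carrier V \<and>
     carrier V = {\<Oplus>\<^bsub>V\<^esub>b\<in>B. c b \<odot>\<^bsub>V\<^esub> b |c. c \<in> B \<rightarrow> carrier K})"

definition lie_subalgebra ::
    "('k, 'm) ring_scheme \<Rightarrow> ('k, 'a, 'r) lie_struct_scheme \<Rightarrow> 'a set \<Rightarrow> bool" where
  "lie_subalgebra K L H \<longleftrightarrow> submodule H K L \<and> (\<forall>x\<in>H. \<forall>y\<in>H. [x, y]\<^sub>L\<^bsub>L\<^esub> \<in> H)"

definition lie_generated ::
    "('k, 'm) ring_scheme \<Rightarrow> ('k, 'a, 'r) lie_struct_scheme \<Rightarrow> 'a set \<Rightarrow> 'a set" where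
  "lie_generated K L X = lie_subalgebra K L hull X"

definition lie_commutator ::
    "('k, 'm) ring_scheme \<Rightarrow> ('k, 'a, 'r) lie_struct_scheme \<Rightarrow> 'a set \<Rightarrow> 'a set \<Rightarrow> 'a set" where
  "lie_commutator K L A B = lie_generated K L {[x, y]\<^sub>L\<^bsub>L\<^esub> |x y. x \<in> A \<and> y \<in> B}"

definition derived_subalgebra ::
    "('k, 'm) ring_scheme \<Rightarrow> ('k, 'a, 'r) lie_struct_scheme \<Rightarrow> 'a set" where
  "derived_subalgebra K L = lie_commutator K L (carrier L) (carrier L)"

definition lie_solvable ::
    "('k, 'm) ring_scheme \<Rightarrow> ('k, 'a, 'r) lie_struct_scheme \<Rightarrow> bool" where
  "lie_solvable K L \<longleftrightarrow>
     (\<exists>d. ((\<lambda>A. lie_commutator K L A A) ^^ d) (carrier L) = {\<zero>\<^bsub>L\<^esub>})"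

definition lie_hom ::
    "('k, 'm) ring_scheme \<Rightarrow> ('k, 'a, 'r) lie_struct_scheme \<Rightarrow>
     ('k, 'b, 'q) lie_struct_scheme \<Rightarrow> ('a \<Rightarrow> 'b) set" where
  "lie_hom K L M = {f \<in> carrier L \<rightarrow> carrier M.
     (\<forall>x\<in>carrier L. \<forall>y\<in>carrier L. f (x \<oplus>\<^bsub>L\<^esub> y) = f x \<oplus>\<^bsub>M\<^esub> f y) \<and>
     (\<forall>a\<in>carrier K. \<forall>x\<in>carrier L. f (a \<odot>\<^bsub>L\<^esub> x) = a \<odot>\<^bsub>M\<^esub> f x) \<and>
     (\<forall>x\<in>carrier L. \<forall>y\<in>carrier L. f [x, y]\<^sub>L\<^bsub>L\<^esub> = [f x, f y]\<^sub>L\<^bsub>M\<^esub>)}"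

text \<open>Derivations are taken extensional, so that equality in \<open>Der L\<close> is
  equality of maps on the carrier of \<open>L\<close>.\<close>

definition derivations ::
    "('k, 'm) ring_scheme \<Rightarrow> ('k, 'a, 'r) lie_struct_scheme \<Rightarrow> ('a \<Rightarrow> 'a) set" where
  "derivations K L = {f \<in> carrier L \<rightarrow>\<^sub>E carrier L.
     (\<forall>x\<in>carrier L. \<forall>y\<in>carrier L. f (x \<oplus>\<^bsub>L\<^esub> y) = f x \<oplus>\<^bsub>L\<^esub> f y) \<and>
     (\<forall>a\<in>carrier K. \<forall>x\<in>carrier L. f (a \<odot>\<^bsub>L\<^esub> x) = a \<odot>\<^bsub>L\<^esub> f x) \<and>
     (\<forall>x\<in>carrier L. \<forall>y\<in>carrier L. f [x, y]\<^sub>L\<^bsub>L\<^esub> = [f x, y]\<^sub>L\<^bsub>L\<^esub> \<oplus>\<^bsub>L\<^esub> [x, f y]\<^sub>L\<^bsub>L\<^esub>)}"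

definition Der ::
    "('k, 'm) ring_scheme \<Rightarrow> ('k, 'a, 'r) lie_struct_scheme \<Rightarrow> ('k, 'a \<Rightarrow> 'a) lie_struct" where
  "Der K L = \<lparr>carrier = derivations K L,
     mult = undefined, one = undefined,
     zero = (\<lambda>x\<in>carrier L. \<zero>\<^bsub>L\<^esub>),
     add = (\<lambda>f g. \<lambda>x\<in>carrier L. f x \<oplus>\<^bsub>L\<^esub> g x),
     smult = (\<lambda>a f. \<lambda>x\<in>carrier L. a \<odot>\<^bsub>L\<^esub> f x),
     bracket = (\<lambda>f g. \<lambda>x\<in>carrier L. f (g x) \<ominus>\<^bsub>L\<^esub> g (f x))\<rparr>"


section \<open>Modules over a Lie algebra\<close>

locale lie_module = lie_algebra K S + V: module K V
  for K :: "('k, 'm) ring_scheme" (structure)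
    and S :: "('k, 's, 'p) lie_struct_scheme" (structure)
    and V :: "('k, 'v, 'q) module_scheme" (structure)
    and act :: "'s \<Rightarrow> 'v \<Rightarrow> 'v" +
  assumes act_closed: "\<lbrakk>x \<in> carrier S; v \<in> carrier V\<rbrakk> \<Longrightarrow> act x v \<in> carrier V"
    and act_add_left: "\<lbrakk>x \<in> carrier S; y \<in> carrier S; v \<in> carrier V\<rbrakk> \<Longrightarrow>
      act (x \<oplus>\<^bsub>S\<^esub> y) v = act x v \<oplus>\<^bsub>V\<^esub> act y v"
    and act_smult_left: "\<lbrakk>a \<in> carrier K; x \<in> carrier S; v \<in> carrier V\<rbrakk> \<Longrightarrow>
      act (a \<odot>\<^bsub>S\<^esub> x) v = a \<odot>\<^bsub>V\<^esub> act x v"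
    and act_add_right: "\<lbrakk>x \<in> carrier S; v \<in> carrier V; w \<in> carrier V\<rbrakk> \<Longrightarrow>
      act x (v \<oplus>\<^bsub>V\<^esub> w) = act x v \<oplus>\<^bsub>V\<^esub> act x w"
    and act_smult_right: "\<lbrakk>a \<in> carrier K; x \<in> carrier S; v \<in> carrier V\<rbrakk> \<Longrightarrow>
      act x (a \<odot>\<^bsub>V\<^esub> v) = a \<odot>\<^bsub>V\<^esub> act x v"
    and act_bracket: "\<lbrakk>x \<in> carrier S; y \<in> carrier S; v \<in> carrier V\<rbrakk> \<Longrightarrow>
      act [x, y]\<^sub>L\<^bsub>S\<^esub> v = act x (act y v) \<ominus>\<^bsub>V\<^esub> act y (act x v)"

definition lie_submodule ::
    "('k, 'm) ring_scheme \<Rightarrow> ('k, 's, 'p) lie_struct_scheme \<Rightarrow>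
     ('k, 'v, 'q) module_scheme \<Rightarrow> ('s \<Rightarrow> 'v \<Rightarrow> 'v) \<Rightarrow> 'v set \<Rightarrow> bool" where
  "lie_submodule K S V act W \<longleftrightarrow>
     submodule W K V \<and> (\<forall>x\<in>carrier S. \<forall>w\<in>W. act x w \<in> W)"

definition irreducible_lie_module ::
    "('k, 'm) ring_scheme \<Rightarrow> ('k, 's, 'p) lie_struct_scheme \<Rightarrow>
     ('k, 'v, 'q) module_scheme \<Rightarrow> ('s \<Rightarrow> 'v \<Rightarrow> 'v) \<Rightarrow> bool" where
  "irreducible_lie_module K S V act \<longleftrightarrow>
     lie_module K S V act \<and> carrier V \<noteq> {\<zero>\<^bsub>V\<^esub>} \<and>
     (\<forall>W. lie_submodule K S V act W \<longrightarrow> W = {\<zero>\<^bsub>V\<^esub>} \<or> W = carrier V)"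

definition completely_reducible_lie_module ::
    "('k, 'm) ring_scheme \<Rightarrow> ('k, 's, 'p) lie_struct_scheme \<Rightarrow>
     ('k, 'v, 'q) module_scheme \<Rightarrow> ('s \<Rightarrow> 'v \<Rightarrow> 'v) \<Rightarrow> bool" where
  "completely_reducible_lie_module K S V act \<longleftrightarrow>
     lie_module K S V act \<and>
     (\<forall>W. lie_submodule K S V act W \<longrightarrow>
       (\<exists>W'. lie_submodule K S V act W' \<and>
             W \<inter> W' = {\<zero>\<^bsub>V\<^esub>} \<and> W <+>\<^bsub>V\<^esub> W' = carrier V))"

text \<open>As for \<^const>\<open>FactRing\<close>, the elements of a quotient are cosets and the operations
  are taken over all representatives. If \<open>N\<close> is a submodule, then
  \<open>a \<odot> (N +> x) = N +> (a \<odot> x)\<close>; if it is stable under \<open>act\<close>, then \<open>s\<close> sends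
  \<open>N +> x\<close> to \<open>N +> act s x\<close>.\<close>

definition quotient_module ::
    "('k, 'v, 'q) module_scheme \<Rightarrow> 'v set \<Rightarrow> ('k, 'v set) module" where
  "quotient_module V N = \<lparr>carrier = a_rcosets\<^bsub>V\<^esub> N,
     mult = undefined, one = undefined,
     zero = N, add = set_add V,
     smult = (\<lambda>a X. \<Union>x\<in>X. N +>\<^bsub>V\<^esub> (a \<odot>\<^bsub>V\<^esub> x))\<rparr>"

definition quotient_action ::
    "('k, 'v, 'q) module_scheme \<Rightarrow> 'v set \<Rightarrow> ('s \<Rightarrow> 'v \<Rightarrow> 'v) \<Rightarrow> 's \<Rightarrow> 'v set \<Rightarrow> 'v set" where
  "quotient_action V N act = (\<lambda>s X. \<Union>x\<in>X. N +>\<^bsub>V\<^esub> act s x)"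


section \<open>Lie algebras acted upon by a Lie algebra\<close>

locale lie_s_algebra = S: lie_algebra K S + N: lie_algebra K N
  for K :: "('k, 'm) ring_scheme" (structure)
    and S :: "('k, 's, 'p) lie_struct_scheme" (structure)
    and N :: "('k, 'n, 'q) lie_struct_scheme" (structure)
    and i :: "'s \<Rightarrow> 'n \<Rightarrow> 'n" +
  assumes hom_Der: "i \<in> lie_hom K S (Der K N)"
    and completely_reducible: "completely_reducible_lie_module K S N i"

definition s_subalgebra ::
    "('k, 'm) ring_scheme \<Rightarrow> ('k, 's, 'p) lie_struct_scheme \<Rightarrow>
     ('k, 'n, 'q) lie_struct_scheme \<Rightarrow> ('s \<Rightarrow> 'n \<Rightarrow> 'n) \<Rightarrow> 'n set \<Rightarrow> bool" where
  "s_subalgebra K S N i H \<longleftrightarrow>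
     lie_subalgebra K N H \<and> (\<forall>x\<in>carrier S. \<forall>v\<in>H. i x v \<in> H)"

text \<open>The bracket of \<open>S\<close> with \<open>A \<subseteq> N\<close> in the semidirect product of \<open>S\<close> and \<open>N\<close>:
  there \<open>[s, v] = i s v\<close> lies in the subalgebra \<open>N\<close>, so the subalgebra generated
  by these elements can be formed in \<open>N\<close>.\<close>

definition s_commutator ::
    "('k, 'm) ring_scheme \<Rightarrow> ('k, 's, 'p) lie_struct_scheme \<Rightarrow>
     ('k, 'n, 'q) lie_struct_scheme \<Rightarrow> ('s \<Rightarrow> 'n \<Rightarrow> 'n) \<Rightarrow> 'n set \<Rightarrow> 'n set" where
  "s_commutator K S N i A = lie_generated K N {i x v |x v. x \<in> carrier S \<and> v \<in> A}"

definition minimal_s_algebra ::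
    "('k, 'm) ring_scheme \<Rightarrow> ('k, 's, 'p) lie_struct_scheme \<Rightarrow>
     ('k, 'n, 'q) lie_struct_scheme \<Rightarrow> ('s \<Rightarrow> 'n \<Rightarrow> 'n) \<Rightarrow> bool" where
  "minimal_s_algebra K S N i \<longleftrightarrow>
     s_commutator K S N i (carrier N) \<noteq> {\<zero>\<^bsub>N\<^esub>} \<and>
     (\<forall>H. s_subalgebra K S N i H \<longrightarrow>
       H = carrier N \<or> s_commutator K S N i H = {\<zero>\<^bsub>N\<^esub>})"

end

theory Submission
  imports Defs
begin

text \<open>
  Write \<open>D\<close> for the derived subalgebra of \<open>\<nn>\<close>. Two facts drive the proof.  By the
  derivation rule \<open>D\<close> and \<open>[\<ss>, \<nn>]\<close> are \<open>\<ss>\<close>-subalgebras, and so is every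
  \<open>\<ss>\<close>-submodule containing \<open>D\<close>, since all brackets lie in \<open>D\<close>; minimality applies to these.  Complete
  reducibility gives \<open>\<ss>\<close>-stable complements: if \<open>\<ss>\<close> kills both summands of
  \<open>\<nn> = W \<oplus> C\<close>, it kills \<open>\<nn>\<close>.

  Let \<open>\<nn>\<close> be minimal. If \<open>H = [\<ss>, \<nn>]\<close> were proper, \<open>\<ss>\<close> would kill \<open>H\<close> by minimality,
  and it would kill a stable complement \<open>C\<close> of \<open>H\<close> because it maps \<open>C\<close> into
  \<open>H \<inter> C = 0\<close>; so \<open>[\<ss>, \<nn>] = \<nn>\<close>.  By solvability \<open>D\<close> is proper, hence
  \<open>[\<ss>, D] = 0\<close>.  For \<open>d \<in> D\<close>, applying \<open>s \<in> \<ss>\<close> to \<open>[v, d] \<in> D\<close> then yields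
  \<open>0 = [s v, d]\<close>, so the centralizer of \<open>D\<close>, a subalgebra, contains the generators of
  \<open>[\<ss>, \<nn>] = \<nn>\<close>, and \<open>[\<nn>, D] = 0\<close>.  Finally let \<open>W \<supseteq> D\<close> be a proper stable
  subspace with stable complement \<open>C\<close>. Then \<open>\<ss>\<close> kills \<open>W\<close>, so it does not kill
  \<open>C\<close>, and minimality applied to the subalgebra \<open>D + C\<close> gives \<open>D + C = \<nn>\<close>; together
  with \<open>W \<inter> C = 0\<close> this forces \<open>W = D\<close>. Hence \<open>\<nn>/D\<close> is irreducible
  (\<open>minimal_imp_irreducible_quotient\<close>).

  Conversely, let \<open>H\<close> be an \<open>\<ss>\<close>-subalgebra. By irreducibility \<open>D + H\<close> is \<open>D\<close> or \<open>\<nn>\<close>.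
  In the first case \<open>H \<subseteq> D\<close> is killed by \<open>\<ss>\<close>.  In the second, centrality of \<open>D\<close>
  means that the bracket of \<open>\<nn> = D + H\<close> depends only on the components in \<open>H\<close>, so
  \<open>[\<nn>, \<nn>] \<subseteq> H\<close>, that is \<open>D \<subseteq> H\<close>, and \<open>H = \<nn>\<close>
  (\<open>supplement_of_central_derived\<close>).
\<close>

section \<open>Submodules and quotient representations\<close>

text \<open>Negation is multiplication by \<open>\<ominus> \<one>\<close>, so closure under negation comes for free.\<close>

lemma (in module) submoduleI_smult:
  assumes "H \<subseteq> carrier M" "\<zero>\<^bsub>M\<^esub> \<in> H"
    and "\<And>x y. \<lbrakk>x \<in> H; y \<in> H\<rbrakk> \<Longrightarrow> x \<oplus>\<^bsub>M\<^esub> y \<in> H"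
    and "\<And>a x. \<lbrakk>a \<in> carrier R; x \<in> H\<rbrakk> \<Longrightarrow> a \<odot>\<^bsub>M\<^esub> x \<in> H"
  shows "submodule H R M"
proof (rule submoduleI)
  fix x assume x: "x \<in> H"
  have "(\<ominus> \<one>) \<odot>\<^bsub>M\<^esub> x = \<ominus>\<^bsub>M\<^esub> x"
    using assms(1) x by (simp add: smult_l_minus subset_iff)
  then show "\<ominus>\<^bsub>M\<^esub> x \<in> H"
    using assms(4)[of "\<ominus> \<one>" x] x by simp
qed (use assms in auto)

lemma (in module) submodule_zero: "submodule H R M \<Longrightarrow> \<zero>\<^bsub>M\<^esub> \<in> H"
  using subgroup.one_closed[OF submodule.axioms(1)] by force

lemma (in module) zero_submodule: "submodule {\<zero>\<^bsub>M\<^esub>} R M"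
  by (rule submoduleI_smult) auto

lemma (in module) submodule_sum_mem:
  "z \<in> A <+>\<^bsub>M\<^esub> B \<longleftrightarrow> (\<exists>a\<in>A. \<exists>b\<in>B. z = a \<oplus>\<^bsub>M\<^esub> b)"
  by (auto simp: set_add_def')

lemma (in module) submodule_sum:
  assumes A: "submodule A R M" and B: "submodule B R M"
  shows "submodule (A <+>\<^bsub>M\<^esub> B) R M" "A \<subseteq> A <+>\<^bsub>M\<^esub> B" "B \<subseteq> A <+>\<^bsub>M\<^esub> B"
proof -
  note A' = submoduleE[OF A] submodule_zero[OF A]
  note B' = submoduleE[OF B] submodule_zero[OF B]
  show "submodule (A <+>\<^bsub>M\<^esub> B) R M"
  proof (rule submoduleI_smult)
    show "A <+>\<^bsub>M\<^esub> B \<subseteq> carrier M"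
      using A'(1) B'(1) by (auto simp: submodule_sum_mem subset_iff)
    show "\<zero>\<^bsub>M\<^esub> \<in> A <+>\<^bsub>M\<^esub> B"
      unfolding submodule_sum_mem using A'(7) B'(7) by (metis M.l_zero M.zero_closed)
  next
    fix x y assume "x \<in> A <+>\<^bsub>M\<^esub> B" "y \<in> A <+>\<^bsub>M\<^esub> B"
    then obtain a b c d where *: "a \<in> A" "c \<in> A" "b \<in> B" "d \<in> B"
      "x = a \<oplus>\<^bsub>M\<^esub> b" "y = c \<oplus>\<^bsub>M\<^esub> d" by (auto simp: submodule_sum_mem)
    then have "x \<oplus>\<^bsub>M\<^esub> y = (a \<oplus>\<^bsub>M\<^esub> c) \<oplus>\<^bsub>M\<^esub> (b \<oplus>\<^bsub>M\<^esub> d)"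
      using A'(1) B'(1) by (simp add: subset_iff M.a_ac)
    then show "x \<oplus>\<^bsub>M\<^esub> y \<in> A <+>\<^bsub>M\<^esub> B"
      unfolding submodule_sum_mem using * A'(5) B'(5) by blast
  next
    fix a x assume a: "a \<in> carrier R" and "x \<in> A <+>\<^bsub>M\<^esub> B"
    then obtain c d where *: "c \<in> A" "d \<in> B" "x = c \<oplus>\<^bsub>M\<^esub> d"
      by (auto simp: submodule_sum_mem)
    then have "a \<odot>\<^bsub>M\<^esub> x = a \<odot>\<^bsub>M\<^esub> c \<oplus>\<^bsub>M\<^esub> a \<odot>\<^bsub>M\<^esub> d"
      using a A'(1) B'(1) by (simp add: subset_iff smult_r_distr)
    then show "a \<odot>\<^bsub>M\<^esub> x \<in> A <+>\<^bsub>M\<^esub> B"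
      unfolding submodule_sum_mem using * a A'(4) B'(4) by blast
  qed
  show "A \<subseteq> A <+>\<^bsub>M\<^esub> B"
    unfolding subset_iff submodule_sum_mem using A'(1) B'(7) by (metis M.r_zero subsetD)
  show "B \<subseteq> A <+>\<^bsub>M\<^esub> B"
    unfolding subset_iff submodule_sum_mem using B'(1) A'(7) by (metis M.l_zero subsetD)
qed

context module
begin

context
  fixes N
  assumes N: "submodule N R M"
begin

lemma coset_mem:
  "y \<in> N +>\<^bsub>M\<^esub> x \<longleftrightarrow> (\<exists>n\<in>N. y = n \<oplus>\<^bsub>M\<^esub> x)"
  by (auto simp: a_r_coset_def')

lemma coset_self: "x \<in> carrier M \<Longrightarrow> x \<in> N +>\<^bsub>M\<^esub> x"
  unfolding coset_mem using submodule_zero[OF N] by (metis M.l_zero)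

lemma coset_eqI: "\<lbrakk>y \<in> N +>\<^bsub>M\<^esub> x; x \<in> carrier M\<rbrakk> \<Longrightarrow> N +>\<^bsub>M\<^esub> y = N +>\<^bsub>M\<^esub> x"
  using a_repr_independence submodule.axioms(1)[OF N] by metis

lemma coset_eq_self_iff: "x \<in> carrier M \<Longrightarrow> N +>\<^bsub>M\<^esub> x = N \<longleftrightarrow> x \<in> N"
  using a_coset_join1 a_coset_join2 submodule.axioms(1)[OF N] by metis

text \<open>The operations of \<^const>\<open>quotient_module\<close> and \<^const>\<open>quotient_action\<close> are unions over
  all representatives. Such a union is the single coset \<open>N +> f x\<close> as soon as \<open>f\<close> is
  additive and preserves \<open>N\<close>, because \<open>f (n \<oplus> x)\<close> and \<open>f x\<close> then differ by
  \<open>f n \<in> N\<close>.\<close>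

lemma coset_map:
  assumes f: "f \<in> carrier M \<rightarrow> carrier M" "f ` N \<subseteq> N"
    and add: "\<And>x y. \<lbrakk>x \<in> carrier M; y \<in> carrier M\<rbrakk> \<Longrightarrow> f (x \<oplus>\<^bsub>M\<^esub> y) = f x \<oplus>\<^bsub>M\<^esub> f y"
    and x: "x \<in> carrier M"
  shows "(\<Union>y\<in>N +>\<^bsub>M\<^esub> x. N +>\<^bsub>M\<^esub> f y) = N +>\<^bsub>M\<^esub> f x"
proof -
  have "N +>\<^bsub>M\<^esub> f y = N +>\<^bsub>M\<^esub> f x" if "y \<in> N +>\<^bsub>M\<^esub> x" for y
  proof -
    from that obtain n where n: "n \<in> N" "y = n \<oplus>\<^bsub>M\<^esub> x" by (auto simp: coset_mem)
    then have "f y = f n \<oplus>\<^bsub>M\<^esub> f x" using add x submoduleE(1)[OF N] by auto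
    then have "f y \<in> N +>\<^bsub>M\<^esub> f x" using n f(2) by (auto simp: coset_mem)
    then show ?thesis using coset_eqI f(1) x by blast
  qed
  then show ?thesis using coset_self[OF x] by blast
qed

lemma quotient_carrier: "carrier (quotient_module M N) = (\<lambda>x. N +>\<^bsub>M\<^esub> x) ` carrier M"
  by (auto simp: quotient_module_def A_RCOSETS_def' a_r_coset_def')

lemma quotient_zero: "\<zero>\<^bsub>quotient_module M N\<^esub> = N"
  by (simp add: quotient_module_def)

lemma quotient_add:
  assumes "x \<in> carrier M" "y \<in> carrier M"
  shows "(N +>\<^bsub>M\<^esub> x) \<oplus>\<^bsub>quotient_module M N\<^esub> (N +>\<^bsub>M\<^esub> y) = N +>\<^bsub>M\<^esub> (x \<oplus>\<^bsub>M\<^esub> y)"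
proof -
  interpret abelian_subgroup N M
    using submodule.axioms(1)[OF N] M.abelian_group_axioms
    by (intro abelian_subgroupI3 additive_subgroupI) auto
  show ?thesis using a_rcos_sum[OF assms] by (simp add: quotient_module_def)
qed

lemma quotient_smult:
  assumes "a \<in> carrier R" "x \<in> carrier M"
  shows "a \<odot>\<^bsub>quotient_module M N\<^esub> (N +>\<^bsub>M\<^esub> x) = N +>\<^bsub>M\<^esub> (a \<odot>\<^bsub>M\<^esub> x)"
  unfolding quotient_module_def module.simps
  by (rule coset_map) (use assms submoduleE(4)[OF N] in \<open>auto simp: smult_r_distr\<close>)

lemma quotient_is_module: "module R (quotient_module M N)"
proof -
  let ?Q = "quotient_module M N"
  note [simp] = quotient_add quotient_smult
  have zero: "\<zero>\<^bsub>?Q\<^esub> = N +>\<^bsub>M\<^esub> \<zero>\<^bsub>M\<^esub>"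
    using coset_eq_self_iff[of "\<zero>\<^bsub>M\<^esub>"] submodule_zero[OF N] by (simp add: quotient_zero)
  show ?thesis
  proof (rule moduleI)
    show "abelian_group ?Q"
    proof (rule abelian_groupI)
      fix X assume "X \<in> carrier ?Q"
      then obtain x where x: "x \<in> carrier M" "X = N +>\<^bsub>M\<^esub> x" by (auto simp: quotient_carrier)
      show "\<exists>Y\<in>carrier ?Q. Y \<oplus>\<^bsub>?Q\<^esub> X = \<zero>\<^bsub>?Q\<^esub>"
        by (rule bexI[of _ "N +>\<^bsub>M\<^esub> (\<ominus>\<^bsub>M\<^esub> x)"]) (use x in \<open>auto simp: quotient_carrier zero M.l_neg\<close>)
    qed (auto simp: quotient_carrier zero M.a_ac)
  qed (auto simp: quotient_carrier smult_l_distr smult_r_distr smult_assoc1 R.is_cring)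
qed

lemma quotient_minus:
  assumes x: "x \<in> carrier M" and y: "y \<in> carrier M"
  shows "(N +>\<^bsub>M\<^esub> x) \<ominus>\<^bsub>quotient_module M N\<^esub> (N +>\<^bsub>M\<^esub> y) = N +>\<^bsub>M\<^esub> (x \<ominus>\<^bsub>M\<^esub> y)"
proof -
  interpret Q: module R "quotient_module M N" by (rule quotient_is_module)
  have "\<ominus>\<^bsub>quotient_module M N\<^esub> (N +>\<^bsub>M\<^esub> y) = (\<ominus> \<one>) \<odot>\<^bsub>quotient_module M N\<^esub> (N +>\<^bsub>M\<^esub> y)"
    using y by (simp add: Q.smult_l_minus quotient_carrier)
  also have "\<dots> = N +>\<^bsub>M\<^esub> (\<ominus>\<^bsub>M\<^esub> y)"
    using y by (simp add: quotient_smult smult_l_minus)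
  finally show ?thesis
    using x y by (simp add: a_minus_def quotient_add)
qed

end

end

context lie_module
begin

lemma lie_submodule_sum:
  assumes "lie_submodule K S V act A" "lie_submodule K S V act B"
  shows "lie_submodule K S V act (A <+>\<^bsub>V\<^esub> B)"
proof -
  have AB: "submodule A K V" "submodule B K V" using assms by (auto simp: lie_submodule_def)
  have "act x z \<in> A <+>\<^bsub>V\<^esub> B" if x: "x \<in> carrier S" and z: "z \<in> A <+>\<^bsub>V\<^esub> B" for x z
  proof -
    from z obtain a b where ab: "a \<in> A" "b \<in> B" "z = a \<oplus>\<^bsub>V\<^esub> b"
      by (auto simp: V.submodule_sum_mem)
    then have "act x z = act x a \<oplus>\<^bsub>V\<^esub> act x b"
      using x V.submoduleE(1)[OF AB(1)] V.submoduleE(1)[OF AB(2)]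
      by (simp add: act_add_right subset_iff)
    then show ?thesis using ab x assms unfolding V.submodule_sum_mem lie_submodule_def by blast
  qed
  then show ?thesis using V.submodule_sum(1)[OF AB] by (simp add: lie_submodule_def)
qed

context
  fixes N
  assumes N: "lie_submodule K S V act N"
begin

lemma quotient_action_coset:
  assumes "x \<in> carrier S" "v \<in> carrier V"
  shows "quotient_action V N act x (N +>\<^bsub>V\<^esub> v) = N +>\<^bsub>V\<^esub> act x v"
  unfolding quotient_action_def
  by (rule V.coset_map)
    (use N assms in \<open>auto simp: lie_submodule_def act_closed act_add_right\<close>)

lemma quotient_lie_module:
  "lie_module K S (quotient_module V N) (quotient_action V N act)"
proof -
  have sub: "submodule N K V" using N by (simp add: lie_submodule_def)
  interpret Q: module K "quotient_module V N" by (rule V.quotient_is_module[OF sub])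
  show ?thesis
    by unfold_locales
      (auto simp: V.quotient_carrier[OF sub] V.quotient_add[OF sub] V.quotient_smult[OF sub]
        V.quotient_minus[OF sub] quotient_action_coset act_closed act_add_left act_add_right
        act_smult_left act_smult_right act_bracket bracket_closed)
qed

text \<open>The correspondence theorem: image and preimage under the projection match the
  submodules of the quotient with the submodules that contain \<open>N\<close>.  It moves
  irreducibility of the quotient into \<open>V\<close> itself, where it can be compared with
  minimality.\<close>

lemma irreducible_quotient_iff:
  "irreducible_lie_module K S (quotient_module V N) (quotient_action V N act) \<longleftrightarrow>
     N \<noteq> carrier V \<and>
     (\<forall>W. lie_submodule K S V act W \<and> N \<subseteq> W \<longrightarrow> W = N \<or> W = carrier V)"
    (is "?irr \<longleftrightarrow> ?proper \<and> ?max")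
proof -
  let ?Q = "quotient_module V N" and ?qact = "quotient_action V N act"
  let ?p = "\<lambda>v. N +>\<^bsub>V\<^esub> v"
  have sub: "submodule N K V" using N by (simp add: lie_submodule_def)
  interpret Q: lie_module K S ?Q ?qact by (rule quotient_lie_module)
  note Nsub = V.submoduleE(1)[OF sub] and zeroN = V.submodule_zero[OF sub]
  note [simp] = V.quotient_carrier[OF sub] V.quotient_add[OF sub] V.quotient_smult[OF sub]
    V.quotient_zero[OF sub] quotient_action_coset
  have p_eq: "?p v = N \<longleftrightarrow> v \<in> N" if "v \<in> carrier V" for v
    using that by (rule V.coset_eq_self_iff[OF sub])
  have proper: "carrier ?Q \<noteq> {N} \<longleftrightarrow> N \<noteq> carrier V"
  proof -
    have "?p ` carrier V = {N} \<longleftrightarrow> (\<forall>v\<in>carrier V. ?p v = N)" using V.M.zero_closed by blast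
    also have "\<dots> \<longleftrightarrow> carrier V \<subseteq> N" using p_eq by blast
    finally show ?thesis using Nsub by auto
  qed
  have image: "lie_submodule K S ?Q ?qact (?p ` W)" if W: "lie_submodule K S V act W" for W
  proof -
    from W have W': "submodule W K V" by (simp add: lie_submodule_def)
    note E = V.submoduleE[OF W'] V.submodule_zero[OF W']
    have "submodule (?p ` W) K ?Q"
    proof (rule Q.V.submoduleI_smult)
      show "\<zero>\<^bsub>?Q\<^esub> \<in> ?p ` W" using E(7) p_eq[of "\<zero>\<^bsub>V\<^esub>"] zeroN by force
    next
      show "?p ` W \<subseteq> carrier ?Q" using E(1) by auto
    next
      fix X Y assume "X \<in> ?p ` W" "Y \<in> ?p ` W"
      then obtain x y where xy: "x \<in> W" "y \<in> W" "X = ?p x" "Y = ?p y" by blast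
      then have "X \<oplus>\<^bsub>?Q\<^esub> Y = ?p (x \<oplus>\<^bsub>V\<^esub> y)" using E(1) by (simp add: subset_iff)
      then show "X \<oplus>\<^bsub>?Q\<^esub> Y \<in> ?p ` W" using E(5) xy by blast
    next
      fix a X assume a: "a \<in> carrier K" and "X \<in> ?p ` W"
      then obtain x where x: "x \<in> W" "X = ?p x" by blast
      then have "a \<odot>\<^bsub>?Q\<^esub> X = ?p (a \<odot>\<^bsub>V\<^esub> x)" using a E(1) by (simp add: subset_iff)
      then show "a \<odot>\<^bsub>?Q\<^esub> X \<in> ?p ` W" using E(4) a x by blast
    qed
    then show ?thesis using W E(1) by (auto simp: lie_submodule_def subset_iff)
  qed
  have preimage: "lie_submodule K S V act {v \<in> carrier V. ?p v \<in> U}"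
    if U: "lie_submodule K S ?Q ?qact U" for U
  proof -
    from U have U': "submodule U K ?Q" by (simp add: lie_submodule_def)
    note E = Q.V.submoduleE[OF U'] Q.V.submodule_zero[OF U']
    have "submodule {v \<in> carrier V. ?p v \<in> U} K V"
    proof (rule V.submoduleI_smult)
      fix x y assume "x \<in> {v \<in> carrier V. ?p v \<in> U}" "y \<in> {v \<in> carrier V. ?p v \<in> U}"
      then show "x \<oplus>\<^bsub>V\<^esub> y \<in> {v \<in> carrier V. ?p v \<in> U}" using E(5)[of "?p x" "?p y"] by auto
    next
      fix a x assume "a \<in> carrier K" "x \<in> {v \<in> carrier V. ?p v \<in> U}"
      then show "a \<odot>\<^bsub>V\<^esub> x \<in> {v \<in> carrier V. ?p v \<in> U}" using E(4)[of a "?p x"] by auto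
    qed (use E(7) p_eq[of "\<zero>\<^bsub>V\<^esub>"] zeroN in auto)
    moreover have "?p (act x v) \<in> U" if "x \<in> carrier S" "v \<in> carrier V" "?p v \<in> U" for x v
      using that U quotient_action_coset[of x v] unfolding lie_submodule_def by metis
    ultimately show ?thesis using U by (auto simp: lie_submodule_def act_closed)
  qed
  show ?thesis
  proof
    assume irr: ?irr
    have "W = N \<or> W = carrier V" if W: "lie_submodule K S V act W" and NW: "N \<subseteq> W" for W
    proof -
      from W have W': "submodule W K V" by (simp add: lie_submodule_def)
      note E = V.submoduleE[OF W']
      \<comment> \<open>\<open>W\<close> is saturated: it contains \<open>N\<close>, hence every coset that it meets.\<close>
      have mem: "v \<in> W" if "?p v \<in> ?p ` W" and v: "v \<in> carrier V" for v
      proof -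
        from that obtain w where w: "w \<in> W" "v \<in> ?p w"
          using V.coset_self[OF sub v] by auto
        then show ?thesis using NW E(5) by (auto simp: V.coset_mem[OF sub])
      qed
      from irr image[OF W] have "?p ` W = {N} \<or> ?p ` W = ?p ` carrier V"
        by (simp add: irreducible_lie_module_def)
      then show ?thesis
      proof
        assume pW: "?p ` W = {N}"
        have "w \<in> N" if w: "w \<in> W" for w
          using pW imageI[OF w, of ?p] p_eq[OF subsetD[OF E(1) w]] by auto
        then have "W \<subseteq> N" by blast
        then show ?thesis using NW by blast
      next
        assume pW: "?p ` W = ?p ` carrier V"
        have "v \<in> W" if v: "v \<in> carrier V" for v
          using mem[OF _ v] pW imageI[OF v, of ?p] by auto
        then have "carrier V \<subseteq> W" by blast
        then show ?thesis using E(1) by blast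
      qed
    qed
    moreover have ?proper using irr proper by (simp add: irreducible_lie_module_def)
    ultimately show "?proper \<and> ?max" by blast
  next
    assume R: "?proper \<and> ?max"
    have "U = {N} \<or> U = carrier ?Q" if U: "lie_submodule K S ?Q ?qact U" for U
    proof -
      from U have U': "submodule U K ?Q" by (simp add: lie_submodule_def)
      note E = Q.V.submoduleE[OF U'] Q.V.submodule_zero[OF U']
      let ?W = "{v \<in> carrier V. ?p v \<in> U}"
      have "U = ?p ` ?W" using E(1) by auto
      moreover have pN: "?p n = N" if "n \<in> N" for n using that Nsub p_eq by blast
      then have "N \<subseteq> ?W" using Nsub E(7) by auto
      then have "?W = N \<or> ?W = carrier V" using R preimage[OF U] by blast
      moreover have "?p ` N = {N}" using pN zeroN by (auto simp: image_iff)
      ultimately show ?thesis by auto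
    qed
    then show ?irr
      using R proper Q.lie_module_axioms by (simp add: irreducible_lie_module_def)
  qed
qed

end

end

section \<open>Generated subalgebras\<close>

context lie_algebra
begin

lemma lie_subalgebra_carrier: "lie_subalgebra K L (carrier L)"
  using carrier_is_submodule bracket_closed by (simp add: lie_subalgebra_def)

lemma bracket_zero_left: "x \<in> carrier L \<Longrightarrow> [\<zero>\<^bsub>L\<^esub>, x]\<^sub>L\<^bsub>L\<^esub> = \<zero>\<^bsub>L\<^esub>"
  using bracket_smult_left[of \<zero> "\<zero>\<^bsub>L\<^esub>" x] bracket_closed by simp

lemma bracket_zero_right: "x \<in> carrier L \<Longrightarrow> [x, \<zero>\<^bsub>L\<^esub>]\<^sub>L\<^bsub>L\<^esub> = \<zero>\<^bsub>L\<^esub>"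
  using bracket_smult_right[of \<zero> x "\<zero>\<^bsub>L\<^esub>"] bracket_closed by simp

text \<open>Polarization: expand \<open>[x + y, x + y] = 0\<close>.\<close>

lemma bracket_commute_zero:
  assumes x: "x \<in> carrier L" and y: "y \<in> carrier L" and "[x, y]\<^sub>L\<^bsub>L\<^esub> = \<zero>\<^bsub>L\<^esub>"
  shows "[y, x]\<^sub>L\<^bsub>L\<^esub> = \<zero>\<^bsub>L\<^esub>"
proof -
  have "\<zero>\<^bsub>L\<^esub> = [x \<oplus>\<^bsub>L\<^esub> y, x \<oplus>\<^bsub>L\<^esub> y]\<^sub>L\<^bsub>L\<^esub>"
    using x y bracket_self[of "x \<oplus>\<^bsub>L\<^esub> y"] by simp
  also have "\<dots> = [y, x]\<^sub>L\<^bsub>L\<^esub>"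
    unfolding bracket_add_left[OF x y M.add.m_closed[OF x y]]
    using assms by (simp add: bracket_add_right bracket_self[OF x] bracket_self[OF y] bracket_closed)
  finally show ?thesis by simp
qed

lemma zero_lie_subalgebra: "lie_subalgebra K L {\<zero>\<^bsub>L\<^esub>}"
  using zero_submodule by (simp add: lie_subalgebra_def bracket_zero_left)

lemma lie_generated_subset: "X \<subseteq> lie_generated K L X"
  by (simp add: lie_generated_def hull_subset)

lemma lie_generated_least:
  "\<lbrakk>X \<subseteq> H; lie_subalgebra K L H\<rbrakk> \<Longrightarrow> lie_generated K L X \<subseteq> H"
  unfolding lie_generated_def by (rule hull_minimal)

lemma lie_subalgebra_generated:
  assumes X: "X \<subseteq> carrier L"
  shows "lie_subalgebra K L (lie_generated K L X)"
proof -
  let ?T = "{T. lie_subalgebra K L T \<and> X \<subseteq> T}"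
  have T: "submodule T K L" if "T \<in> ?T" for T using that by (simp add: lie_subalgebra_def)
  have "submodule (\<Inter>?T) K L"
  proof (rule submoduleI_smult)
    show "\<Inter>?T \<subseteq> carrier L" using X lie_subalgebra_carrier by blast
    show "\<zero>\<^bsub>L\<^esub> \<in> \<Inter>?T" using submodule_zero T by blast
    show "\<And>x y. \<lbrakk>x \<in> \<Inter>?T; y \<in> \<Inter>?T\<rbrakk> \<Longrightarrow> x \<oplus>\<^bsub>L\<^esub> y \<in> \<Inter>?T"
      using submoduleE(5)[OF T] by blast
    show "\<And>a x. \<lbrakk>a \<in> carrier K; x \<in> \<Inter>?T\<rbrakk> \<Longrightarrow> a \<odot>\<^bsub>L\<^esub> x \<in> \<Inter>?T"
      using submoduleE(4)[OF T] by blast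
  qed
  then show ?thesis
    unfolding lie_generated_def hull_def by (auto simp: lie_subalgebra_def)
qed

lemma lie_generated_eq_zero_iff:
  assumes "X \<subseteq> carrier L"
  shows "lie_generated K L X = {\<zero>\<^bsub>L\<^esub>} \<longleftrightarrow> X \<subseteq> {\<zero>\<^bsub>L\<^esub>}"
  using lie_generated_subset[of X] lie_generated_least[OF _ zero_lie_subalgebra]
    lie_subalgebra_generated[OF assms] submodule_zero
  unfolding lie_subalgebra_def by blast

text \<open>By the derivation rule, the elements of the generated subalgebra that \<open>f\<close> maps back
  into it form a subalgebra, so stability need only be checked on generators.\<close>

lemma lie_generated_stable:
  assumes X: "X \<subseteq> carrier L" and f: "f \<in> derivations K L"
    and fX: "f ` X \<subseteq> lie_generated K L X"
  shows "f ` lie_generated K L X \<subseteq> lie_generated K L X"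
proof -
  let ?G = "lie_generated K L X"
  have G: "lie_subalgebra K L ?G" by (rule lie_subalgebra_generated[OF X])
  then have G': "submodule ?G K L" by (simp add: lie_subalgebra_def)
  note E = submoduleE[OF G'] submodule_zero[OF G']
  have brG: "[x, y]\<^sub>L\<^bsub>L\<^esub> \<in> ?G" if "x \<in> ?G" "y \<in> ?G" for x y
    using G that by (simp add: lie_subalgebra_def)
  have fcl: "f x \<in> carrier L" if "x \<in> carrier L" for x
    using f that by (auto simp: derivations_def)
  have fadd: "f (x \<oplus>\<^bsub>L\<^esub> y) = f x \<oplus>\<^bsub>L\<^esub> f y" if "x \<in> carrier L" "y \<in> carrier L" for x y
    using f that by (auto simp: derivations_def)
  have fsmult: "f (a \<odot>\<^bsub>L\<^esub> x) = a \<odot>\<^bsub>L\<^esub> f x" if "a \<in> carrier K" "x \<in> carrier L" for a x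
    using f that by (auto simp: derivations_def)
  have fbr: "f [x, y]\<^sub>L\<^bsub>L\<^esub> = [f x, y]\<^sub>L\<^bsub>L\<^esub> \<oplus>\<^bsub>L\<^esub> [x, f y]\<^sub>L\<^bsub>L\<^esub>"
    if "x \<in> carrier L" "y \<in> carrier L" for x y
    using f that by (auto simp: derivations_def)
  let ?H = "{x \<in> ?G. f x \<in> ?G}"
  have "submodule ?H K L"
  proof (rule submoduleI_smult)
    show "\<zero>\<^bsub>L\<^esub> \<in> ?H"
      using E(7) fsmult[of \<zero> "\<zero>\<^bsub>L\<^esub>"] fcl[of "\<zero>\<^bsub>L\<^esub>"] by simp
  qed (use E in \<open>auto simp: fadd fsmult subset_iff\<close>)
  moreover have "[x, y]\<^sub>L\<^bsub>L\<^esub> \<in> ?H" if "x \<in> ?H" "y \<in> ?H" for x y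
    using that brG E(5) fbr E(1) by (auto simp: subset_iff)
  ultimately have "lie_subalgebra K L ?H" by (simp add: lie_subalgebra_def)
  then have "?G \<subseteq> ?H"
    using lie_generated_subset[of X] fX by (intro lie_generated_least) auto
  then show ?thesis by blast
qed

lemma brackets_subset_carrier:
  "\<lbrakk>A \<subseteq> carrier L; B \<subseteq> carrier L\<rbrakk> \<Longrightarrow> {[x, y]\<^sub>L\<^bsub>L\<^esub> |x y. x \<in> A \<and> y \<in> B} \<subseteq> carrier L"
  using bracket_closed by blast

lemma lie_commutator_eq_zero_iff:
  assumes "A \<subseteq> carrier L" "B \<subseteq> carrier L"
  shows "lie_commutator K L A B = {\<zero>\<^bsub>L\<^esub>} \<longleftrightarrow> (\<forall>x\<in>A. \<forall>y\<in>B. [x, y]\<^sub>L\<^bsub>L\<^esub> = \<zero>\<^bsub>L\<^esub>)"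
  unfolding lie_commutator_def lie_generated_eq_zero_iff[OF brackets_subset_carrier[OF assms]]
  by blast

lemma lie_subalgebra_derived: "lie_subalgebra K L (derived_subalgebra K L)"
  unfolding derived_subalgebra_def lie_commutator_def
  by (rule lie_subalgebra_generated) (auto simp: bracket_closed)

lemma derived_subset_carrier: "derived_subalgebra K L \<subseteq> carrier L"
  using lie_subalgebra_derived submoduleE(1) by (auto simp: lie_subalgebra_def)

lemma bracket_in_derived:
  "\<lbrakk>x \<in> carrier L; y \<in> carrier L\<rbrakk> \<Longrightarrow> [x, y]\<^sub>L\<^bsub>L\<^esub> \<in> derived_subalgebra K L"
  unfolding derived_subalgebra_def lie_commutator_def
  by (rule subsetD[OF lie_generated_subset]) blast

lemma derived_least:
  assumes "lie_subalgebra K L H"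
    and "\<And>x y. \<lbrakk>x \<in> carrier L; y \<in> carrier L\<rbrakk> \<Longrightarrow> [x, y]\<^sub>L\<^bsub>L\<^esub> \<in> H"
  shows "derived_subalgebra K L \<subseteq> H"
  unfolding derived_subalgebra_def lie_commutator_def
  by (rule lie_generated_least[OF _ assms(1)]) (auto intro: assms(2))

lemma lie_subalgebra_above_derived:
  assumes H: "submodule H K L" and DH: "derived_subalgebra K L \<subseteq> H"
  shows "lie_subalgebra K L H"
  unfolding lie_subalgebra_def
proof (intro conjI ballI H)
  fix x y assume "x \<in> H" "y \<in> H"
  then have "x \<in> carrier L" "y \<in> carrier L" using submoduleE(1)[OF H] by auto
  then show "[x, y]\<^sub>L\<^bsub>L\<^esub> \<in> H" using DH bracket_in_derived[of x y] by auto
qed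

lemma derived_stable:
  assumes "f \<in> derivations K L"
  shows "f ` derived_subalgebra K L \<subseteq> derived_subalgebra K L"
proof -
  have "f [x, y]\<^sub>L\<^bsub>L\<^esub> \<in> derived_subalgebra K L" if "x \<in> carrier L" "y \<in> carrier L" for x y
  proof -
    have "f x \<in> carrier L" "f y \<in> carrier L"
      "f [x, y]\<^sub>L\<^bsub>L\<^esub> = [f x, y]\<^sub>L\<^bsub>L\<^esub> \<oplus>\<^bsub>L\<^esub> [x, f y]\<^sub>L\<^bsub>L\<^esub>"
      using assms that by (auto simp: derivations_def)
    then show ?thesis
      using that lie_subalgebra_derived submoduleE(5) bracket_in_derived
      by (auto simp: lie_subalgebra_def)
  qed
  then show ?thesis
    unfolding derived_subalgebra_def lie_commutator_def
    by (intro lie_generated_stable assms) (auto simp: bracket_closed)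
qed

text \<open>If the derived subalgebra were everything, the derived series would be constant and
  could not reach zero.\<close>

lemma solvable_derived_proper:
  assumes "lie_solvable K L" "carrier L \<noteq> {\<zero>\<^bsub>L\<^esub>}"
  shows "derived_subalgebra K L \<noteq> carrier L"
proof
  assume *: "derived_subalgebra K L = carrier L"
  have "((\<lambda>A. lie_commutator K L A A) ^^ d) (carrier L) = carrier L" for d
    by (induction d) (use * in \<open>simp_all add: derived_subalgebra_def\<close>)
  then show False using assms by (simp add: lie_solvable_def)
qed

text \<open>Closure under the bracket is the Jacobi identity: two of its three terms vanish.\<close>

lemma centralizer_lie_subalgebra:
  assumes B: "B \<subseteq> carrier L"
  shows "lie_subalgebra K L {x \<in> carrier L. \<forall>b\<in>B. [x, b]\<^sub>L\<^bsub>L\<^esub> = \<zero>\<^bsub>L\<^esub>}" (is "lie_subalgebra K L ?C")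
proof -
  have "submodule ?C K L"
    by (rule submoduleI_smult)
      (use B in \<open>auto simp: bracket_zero_left bracket_add_left bracket_smult_left subset_iff\<close>)
  moreover have "[[x, y]\<^sub>L\<^bsub>L\<^esub>, b]\<^sub>L\<^bsub>L\<^esub> = \<zero>\<^bsub>L\<^esub>" if x: "x \<in> ?C" and y: "y \<in> ?C" and b: "b \<in> B" for x y b
  proof -
    have c: "x \<in> carrier L" "y \<in> carrier L" "b \<in> carrier L" using x y b B by auto
    have "[y, b]\<^sub>L\<^bsub>L\<^esub> = \<zero>\<^bsub>L\<^esub>" "[b, x]\<^sub>L\<^bsub>L\<^esub> = \<zero>\<^bsub>L\<^esub>"
      using x y b bracket_commute_zero[of x b] c by auto
    then have "[b, [x, y]\<^sub>L\<^bsub>L\<^esub>]\<^sub>L\<^bsub>L\<^esub> = \<zero>\<^bsub>L\<^esub>"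
      using jacobi[of x y b] c by (simp add: bracket_zero_right bracket_closed)
    then show ?thesis
      using bracket_commute_zero[OF c(3) bracket_closed[OF c(1,2)]] by simp
  qed
  moreover have "[x, y]\<^sub>L\<^bsub>L\<^esub> \<in> carrier L" if "x \<in> ?C" "y \<in> ?C" for x y
    using that by (simp add: bracket_closed)
  ultimately show ?thesis unfolding lie_subalgebra_def by blast
qed

end

section \<open>Minimal algebras\<close>

sublocale lie_s_algebra \<subseteq> rep: lie_module K S N i
  using completely_reducible by (simp add: completely_reducible_lie_module_def)

context lie_s_algebra
begin

abbreviation D where "D \<equiv> derived_subalgebra K N"

lemma action_derivation: "x \<in> carrier S \<Longrightarrow> i x \<in> derivations K N"
  using hom_Der by (auto simp: lie_hom_def Der_def)

lemma action_bracket: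
  "\<lbrakk>x \<in> carrier S; v \<in> carrier N; w \<in> carrier N\<rbrakk> \<Longrightarrow>
    i x [v, w]\<^sub>L\<^bsub>N\<^esub> = [i x v, w]\<^sub>L\<^bsub>N\<^esub> \<oplus>\<^bsub>N\<^esub> [v, i x w]\<^sub>L\<^bsub>N\<^esub>"
  using action_derivation[of x] by (auto simp: derivations_def)

lemma s_subalgebra_iff:
  "s_subalgebra K S N i H \<longleftrightarrow> lie_subalgebra K N H \<and> lie_submodule K S N i H"
  by (auto simp: s_subalgebra_def lie_submodule_def lie_subalgebra_def)

lemma s_commutator_eq_zero_iff:
  assumes "A \<subseteq> carrier N"
  shows "s_commutator K S N i A = {\<zero>\<^bsub>N\<^esub>} \<longleftrightarrow> (\<forall>x\<in>carrier S. \<forall>v\<in>A. i x v = \<zero>\<^bsub>N\<^esub>)"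
proof -
  have "{i x v |x v. x \<in> carrier S \<and> v \<in> A} \<subseteq> carrier N"
    using assms rep.act_closed by blast
  from N.lie_generated_eq_zero_iff[OF this] show ?thesis
    unfolding s_commutator_def by blast
qed

lemma s_subalgebra_derived: "s_subalgebra K S N i D"
  using N.lie_subalgebra_derived N.derived_stable action_derivation
  by (auto simp: s_subalgebra_def)

lemma s_subalgebra_s_commutator: "s_subalgebra K S N i (s_commutator K S N i (carrier N))"
proof -
  let ?X = "{i x v |x v. x \<in> carrier S \<and> v \<in> carrier N}"
  have X: "?X \<subseteq> carrier N" using rep.act_closed by blast
  have "i y ` ?X \<subseteq> lie_generated K N ?X" if "y \<in> carrier S" for y
    using that X N.lie_generated_subset[of ?X] by blast
  from N.lie_generated_stable[OF X action_derivation this] show ?thesis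
    using N.lie_subalgebra_generated[OF X]
    by (auto simp: s_subalgebra_def s_commutator_def)
qed

lemma complement:
  assumes "lie_submodule K S N i W"
  obtains C where "lie_submodule K S N i C" "W \<inter> C = {\<zero>\<^bsub>N\<^esub>}" "W <+>\<^bsub>N\<^esub> C = carrier N"
  using assms completely_reducible by (auto simp: completely_reducible_lie_module_def)

lemma trivial_action_sum:
  assumes W: "lie_submodule K S N i W" and C: "lie_submodule K S N i C"
    and WC: "W <+>\<^bsub>N\<^esub> C = carrier N"
    and "\<forall>x\<in>carrier S. \<forall>v\<in>W. i x v = \<zero>\<^bsub>N\<^esub>" "\<forall>x\<in>carrier S. \<forall>v\<in>C. i x v = \<zero>\<^bsub>N\<^esub>"
  shows "\<forall>x\<in>carrier S. \<forall>v\<in>carrier N. i x v = \<zero>\<^bsub>N\<^esub>"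
proof (intro ballI)
  fix x v assume x: "x \<in> carrier S" and "v \<in> carrier N"
  then obtain w c where wc: "w \<in> W" "c \<in> C" "v = w \<oplus>\<^bsub>N\<^esub> c"
    unfolding WC[symmetric] by (auto simp: N.submodule_sum_mem)
  have "w \<in> carrier N" "c \<in> carrier N"
    using wc W C N.submoduleE(1) by (auto simp: lie_submodule_def)
  then show "i x v = \<zero>\<^bsub>N\<^esub>" using assms(4,5) x wc by (simp add: rep.act_add_right)
qed

text \<open>Otherwise \<open>S\<close> acts trivially on \<open>[S, N]\<close>, and it also acts trivially on a stable
  complement \<open>C\<close>, since it maps \<open>C\<close> both into \<open>C\<close> and into \<open>[S, N]\<close>.\<close>

lemma minimal_imp_s_commutator:
  assumes "minimal_s_algebra K S N i"
  shows "s_commutator K S N i (carrier N) = carrier N"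
proof (rule ccontr)
  let ?H = "s_commutator K S N i (carrier N)"
  assume "?H \<noteq> carrier N"
  then have "s_commutator K S N i ?H = {\<zero>\<^bsub>N\<^esub>}"
    using assms s_subalgebra_s_commutator by (auto simp: minimal_s_algebra_def)
  moreover have H: "lie_submodule K S N i ?H"
    using s_subalgebra_s_commutator by (simp add: s_subalgebra_iff)
  moreover have "?H \<subseteq> carrier N"
    using H N.submoduleE(1) by (auto simp: lie_submodule_def)
  ultimately have triv: "\<forall>x\<in>carrier S. \<forall>v\<in>?H. i x v = \<zero>\<^bsub>N\<^esub>"
    by (simp add: s_commutator_eq_zero_iff)
  from complement[OF H] obtain C where C: "lie_submodule K S N i C"
    "?H \<inter> C = {\<zero>\<^bsub>N\<^esub>}" "?H <+>\<^bsub>N\<^esub> C = carrier N" .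
  have "i x c = \<zero>\<^bsub>N\<^esub>" if "x \<in> carrier S" "c \<in> C" for x c
  proof -
    have "c \<in> carrier N" using C(1) that N.submoduleE(1) by (auto simp: lie_submodule_def)
    then have "i x c \<in> ?H"
      unfolding s_commutator_def
      by (intro subsetD[OF N.lie_generated_subset]) (use that in blast)
    moreover have "i x c \<in> C" using C(1) that by (auto simp: lie_submodule_def)
    ultimately show ?thesis using C(2) by blast
  qed
  then have "\<forall>x\<in>carrier S. \<forall>v\<in>carrier N. i x v = \<zero>\<^bsub>N\<^esub>"
    using trivial_action_sum[OF H C(1,3) triv] by blast
  then show False
    using assms by (simp add: minimal_s_algebra_def s_commutator_eq_zero_iff)
qed

text \<open>Stable subspaces above \<open>D\<close> are subalgebras, so minimality applies to them.  It is
  used twice: a proper such \<open>W\<close> has trivial action, and then \<open>D + C\<close>, with \<open>C\<close> a stable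
  complement of \<open>W\<close>, cannot have trivial action and must be everything.\<close>

lemma minimal_imp_irreducible_quotient:
  assumes min: "minimal_s_algebra K S N i" and proper: "D \<noteq> carrier N"
  shows "irreducible_lie_module K S (quotient_module N D) (quotient_action N D i)"
proof -
  have D: "lie_submodule K S N i D" "submodule D K N"
    using s_subalgebra_derived by (auto simp: s_subalgebra_iff lie_submodule_def)
  have nontriv: "\<not> (\<forall>x\<in>carrier S. \<forall>v\<in>carrier N. i x v = \<zero>\<^bsub>N\<^esub>)"
    using min by (simp add: minimal_s_algebra_def s_commutator_eq_zero_iff)
  have dichotomy: "W = carrier N \<or> (\<forall>x\<in>carrier S. \<forall>v\<in>W. i x v = \<zero>\<^bsub>N\<^esub>)"
    if W: "lie_submodule K S N i W" "D \<subseteq> W" for W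
  proof -
    have "submodule W K N" using W by (simp add: lie_submodule_def)
    then have "s_subalgebra K S N i W" "W \<subseteq> carrier N"
      using W N.lie_subalgebra_above_derived N.submoduleE(1) by (auto simp: s_subalgebra_iff)
    then show ?thesis using min by (auto simp: minimal_s_algebra_def s_commutator_eq_zero_iff)
  qed
  have "W = D \<or> W = carrier N" if W: "lie_submodule K S N i W" and DW: "D \<subseteq> W" for W
  proof (cases "W = carrier N")
    case False
    then have trivW: "\<forall>x\<in>carrier S. \<forall>v\<in>W. i x v = \<zero>\<^bsub>N\<^esub>" using dichotomy W DW by blast
    from complement[OF W] obtain C where C: "lie_submodule K S N i C"
      "W \<inter> C = {\<zero>\<^bsub>N\<^esub>}" "W <+>\<^bsub>N\<^esub> C = carrier N" .
    have W': "submodule W K N" and C': "submodule C K N"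
      using W C by (auto simp: lie_submodule_def)
    have DC: "D \<subseteq> D <+>\<^bsub>N\<^esub> C" "C \<subseteq> D <+>\<^bsub>N\<^esub> C"
      using N.submodule_sum(2,3)[OF D(2) C'] .
    have "\<not> (\<forall>x\<in>carrier S. \<forall>v\<in>D <+>\<^bsub>N\<^esub> C. i x v = \<zero>\<^bsub>N\<^esub>)"
      using trivial_action_sum[OF W C(1,3) trivW] nontriv DC(2) by blast
    then have full: "D <+>\<^bsub>N\<^esub> C = carrier N"
      using dichotomy[OF rep.lie_submodule_sum[OF D(1) C(1)] DC(1)] by blast
    \<comment> \<open>The modular law \<open>W = W \<inter> (D + C) = D + (W \<inter> C)\<close> with \<open>W \<inter> C = 0\<close>.\<close>
    have "w \<in> D" if w: "w \<in> W" for w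
    proof -
      from w full obtain d c where dc: "d \<in> D" "c \<in> C" "w = d \<oplus>\<^bsub>N\<^esub> c"
        using N.submoduleE(1)[OF W'] by (metis N.submodule_sum_mem subsetD)
      have carr: "d \<in> carrier N" "c \<in> carrier N"
        using dc N.submoduleE(1) D(2) C' by blast+
      have "\<ominus>\<^bsub>N\<^esub> d \<oplus>\<^bsub>N\<^esub> w \<in> W"
        using N.submoduleE(3,5)[OF W'] dc(1) DW w by blast
      moreover have "\<ominus>\<^bsub>N\<^esub> d \<oplus>\<^bsub>N\<^esub> w = c" using carr dc(3) by (simp add: N.r_neg1)
      ultimately have "c = \<zero>\<^bsub>N\<^esub>" using C(2) dc(2) by blast
      then show ?thesis using dc carr by simp
    qed
    then show ?thesis using DW by blast
  qed simp
  then show ?thesis using rep.irreducible_quotient_iff[OF D(1)] proper by blast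
qed

text \<open>Since \<open>S\<close> kills \<open>D\<close>, applying \<open>x \<in> S\<close> to \<open>[v, d] \<in> D\<close> gives
  \<open>[x v, d] = 0\<close>: the generators of \<open>[S, N]\<close> centralize \<open>D\<close>.\<close>

lemma derived_central:
  assumes full: "s_commutator K S N i (carrier N) = carrier N"
    and triv: "\<forall>x\<in>carrier S. \<forall>v\<in>D. i x v = \<zero>\<^bsub>N\<^esub>"
  shows "\<forall>v\<in>carrier N. \<forall>d\<in>D. [v, d]\<^sub>L\<^bsub>N\<^esub> = \<zero>\<^bsub>N\<^esub>"
proof -
  note Dsub = N.derived_subset_carrier
  let ?C = "{v \<in> carrier N. \<forall>d\<in>D. [v, d]\<^sub>L\<^bsub>N\<^esub> = \<zero>\<^bsub>N\<^esub>}"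
  have "i x v \<in> ?C" if x: "x \<in> carrier S" and v: "v \<in> carrier N" for x v
  proof -
    have "[i x v, d]\<^sub>L\<^bsub>N\<^esub> = \<zero>\<^bsub>N\<^esub>" if d: "d \<in> D" for d
    proof -
      have d': "d \<in> carrier N" using d Dsub by blast
      have "\<zero>\<^bsub>N\<^esub> = i x [v, d]\<^sub>L\<^bsub>N\<^esub>" using triv x N.bracket_in_derived[OF v d'] by simp
      also have "\<dots> = [i x v, d]\<^sub>L\<^bsub>N\<^esub>"
        using action_bracket[OF x v d'] triv x d v d'
        by (simp add: N.bracket_zero_right N.bracket_closed rep.act_closed)
      finally show ?thesis by simp
    qed
    then show ?thesis using x v by (simp add: rep.act_closed)
  qed
  then have "s_commutator K S N i (carrier N) \<subseteq> ?C"
    unfolding s_commutator_def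
    by (intro N.lie_generated_least N.centralizer_lie_subalgebra Dsub) blast
  then show ?thesis using full by blast
qed

text \<open>Modulo central elements only the components in \<open>H\<close> contribute to a bracket, so every
  bracket of \<open>N = D + H\<close> lies in \<open>H\<close>; hence \<open>D \<subseteq> H\<close>.\<close>

lemma supplement_of_central_derived:
  assumes H: "lie_subalgebra K N H" and central: "\<forall>v\<in>carrier N. \<forall>d\<in>D. [v, d]\<^sub>L\<^bsub>N\<^esub> = \<zero>\<^bsub>N\<^esub>"
    and sum: "D <+>\<^bsub>N\<^esub> H = carrier N"
  shows "H = carrier N"
proof -
  have H': "submodule H K N" using H by (simp add: lie_subalgebra_def)
  note Hsub = N.submoduleE(1)[OF H'] and Dsub = N.derived_subset_carrier
  have "[v, w]\<^sub>L\<^bsub>N\<^esub> \<in> H" if v: "v \<in> carrier N" and w: "w \<in> carrier N" for v w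
  proof -
    from v obtain d h where dh: "d \<in> D" "h \<in> H" "v = d \<oplus>\<^bsub>N\<^esub> h"
      using sum by (metis N.submodule_sum_mem)
    from w obtain d' h' where dh': "d' \<in> D" "h' \<in> H" "w = d' \<oplus>\<^bsub>N\<^esub> h'"
      using sum by (metis N.submodule_sum_mem)
    have c: "d \<in> carrier N" "h \<in> carrier N" "d' \<in> carrier N" "h' \<in> carrier N"
      using dh dh' Hsub Dsub by auto
    have z: "[d, d']\<^sub>L\<^bsub>N\<^esub> = \<zero>\<^bsub>N\<^esub>" "[h, d']\<^sub>L\<^bsub>N\<^esub> = \<zero>\<^bsub>N\<^esub>" "[d, h']\<^sub>L\<^bsub>N\<^esub> = \<zero>\<^bsub>N\<^esub>"
      using central c dh(1) dh'(1) N.bracket_commute_zero[of h' d] by auto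
    have "[v, w]\<^sub>L\<^bsub>N\<^esub> = [h, h']\<^sub>L\<^bsub>N\<^esub>"
      using c z by (simp add: dh(3) dh'(3) N.bracket_add_left N.bracket_add_right N.bracket_closed)
    then show ?thesis using H dh(2) dh'(2) by (simp add: lie_subalgebra_def)
  qed
  then have "D \<subseteq> H" using N.derived_least[OF H] by auto
  then have "D <+>\<^bsub>N\<^esub> H \<subseteq> H" using N.submoduleE(5)[OF H'] by (auto simp: N.submodule_sum_mem subset_iff)
  then show ?thesis using sum Hsub by blast
qed

lemma minimalI:
  assumes central: "\<forall>v\<in>carrier N. \<forall>d\<in>D. [v, d]\<^sub>L\<^bsub>N\<^esub> = \<zero>\<^bsub>N\<^esub>"
    and full: "s_commutator K S N i (carrier N) = carrier N"
    and triv: "\<forall>x\<in>carrier S. \<forall>v\<in>D. i x v = \<zero>\<^bsub>N\<^esub>"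
    and irr: "irreducible_lie_module K S (quotient_module N D) (quotient_action N D i)"
  shows "minimal_s_algebra K S N i"
  unfolding minimal_s_algebra_def
proof (intro conjI allI impI)
  have D: "lie_submodule K S N i D" "submodule D K N"
    using s_subalgebra_derived by (auto simp: s_subalgebra_iff lie_submodule_def)
  note irr' = irr[unfolded rep.irreducible_quotient_iff[OF D(1)]]
  show "s_commutator K S N i (carrier N) \<noteq> {\<zero>\<^bsub>N\<^esub>}"
    using irr' full N.derived_subset_carrier N.submodule_zero[OF D(2)] by auto
  fix H assume H: "s_subalgebra K S N i H"
  then have H': "lie_submodule K S N i H" "submodule H K N"
    by (auto simp: s_subalgebra_iff lie_submodule_def)
  note sum = N.submodule_sum(2,3)[OF D(2) H'(2)]
  from irr' rep.lie_submodule_sum[OF D(1) H'(1)] sum(1)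
  have "D <+>\<^bsub>N\<^esub> H = D \<or> D <+>\<^bsub>N\<^esub> H = carrier N" by blast
  then show "H = carrier N \<or> s_commutator K S N i H = {\<zero>\<^bsub>N\<^esub>}"
  proof
    assume "D <+>\<^bsub>N\<^esub> H = D"
    then have "\<forall>x\<in>carrier S. \<forall>v\<in>H. i x v = \<zero>\<^bsub>N\<^esub>" using sum(2) triv by blast
    then show ?thesis
      using s_commutator_eq_zero_iff N.submoduleE(1)[OF H'(2)] by blast
  next
    assume "D <+>\<^bsub>N\<^esub> H = carrier N"
    then show ?thesis using supplement_of_central_derived central H by (auto simp: s_subalgebra_iff)
  qed
qed

end

theorem theorem1p2:
  fixes K :: "('k, 'm) ring_scheme"
    and \<ss> :: "('k, 's, 'p) lie_struct_scheme"
    and \<nn> :: "('k, 'n, 'q) lie_struct_scheme"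
    and i :: "'s \<Rightarrow> 'n \<Rightarrow> 'n"
  assumes "field K" and "char_zero K"
    and "lie_algebra K \<ss>" and "finite_dimensional K \<ss>"
    and "lie_s_algebra K \<ss> \<nn> i" and "finite_dimensional K \<nn>"
    and "lie_solvable K \<nn>"
  shows "minimal_s_algebra K \<ss> \<nn> i \<longleftrightarrow>
     lie_commutator K \<nn> (carrier \<nn>) (derived_subalgebra K \<nn>) = {\<zero>\<^bsub>\<nn>\<^esub>} \<and>
     s_commutator K \<ss> \<nn> i (carrier \<nn>) = carrier \<nn> \<and>
     s_commutator K \<ss> \<nn> i (derived_subalgebra K \<nn>) = {\<zero>\<^bsub>\<nn>\<^esub>} \<and>
     irreducible_lie_module K \<ss>
       (quotient_module \<nn> (derived_subalgebra K \<nn>))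
       (quotient_action \<nn> (derived_subalgebra K \<nn>) i)"
proof -
  interpret lie_s_algebra K \<ss> \<nn> i by (rule assms)
  note nil_iff = N.lie_commutator_eq_zero_iff[OF subset_refl N.derived_subset_carrier]
    and triv_iff = s_commutator_eq_zero_iff[OF N.derived_subset_carrier]
  show ?thesis (is "_ \<longleftrightarrow> ?R")
  proof
    assume min: "minimal_s_algebra K \<ss> \<nn> i"
    have full: "s_commutator K \<ss> \<nn> i (carrier \<nn>) = carrier \<nn>"
      by (rule minimal_imp_s_commutator[OF min])
    then have "carrier \<nn> \<noteq> {\<zero>\<^bsub>\<nn>\<^esub>}" using min by (simp add: minimal_s_algebra_def)
    then have proper: "D \<noteq> carrier \<nn>" by (rule N.solvable_derived_proper[OF assms(7)])
    then have triv: "s_commutator K \<ss> \<nn> i D = {\<zero>\<^bsub>\<nn>\<^esub>}"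
      using min s_subalgebra_derived by (auto simp: minimal_s_algebra_def)
    show ?R
      using derived_central[OF full] full triv
        minimal_imp_irreducible_quotient[OF min proper] nil_iff triv_iff by blast
  next
    assume ?R
    then show "minimal_s_algebra K \<ss> \<nn> i" using minimalI nil_iff triv_iff by blast
  qed
qed

end
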